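(* Let $1\le k\le n$. Then: (i) if $n=k$, $F_{n,k}(1/23)=(rs)^{\binom{k}{2}}$; (ii) if $n>k$, $$F_{n,k}(1/23)=\sum_{j=1}^{k}(qt)^{j-1}\,r^{\binom{k}{2}}\,s^{(n-k)(k-1)+(k-j)+\binom{k-1}{2}}.$$
   Context: A set partition $\pi=B_1/B_2/\cdots/B_k$ of $[n]=\{1,\dots,n\}$ is written with its blocks ordered so that $\min B_1<\min B_2<\cdots<\min B_k$. For $S\subseteq[n]$, restrict $\pi$ to $S$ by taking the nonempty intersections $B_i\cap S$, and standardize by replacing the smallest element of $S$ by $1$, the second smallest by $2$, etc. The partition $\pi$ contains a partition $\omega$ if the standardized restriction to some $S$ equals $\omega$; otherwise $\pi$ avoids $\omega$. $\Pi_{n,k}(\omega)$ is the set of partitions of $[n]$ with exactly $k$ blocks that avoid $\omega$. Here $1/23$ denotes the partition $\{\{1\},\{2,3\}\}$ of $[3]$. The restricted growth function (RGF) of $\pi$ is the word $w(\pi)=a_1\cdots a_n$ with $a_i=j$ iff $i\in B_j$. For a word $w=a_1\cdots a_n$ put $lb(a_j)=\#\{a_i: i<j,\ a_i>a_j\}$, $ls(a_j)=\#\{a_i: i<j,\ a_i<a_j\}$, $rb(a_j)=\#\{a_i: i>j,\ a_i>a_j\}$, $rs(a_j)=\#\{a_i: i>j,\ a_i<a_j\}$, where each is the cardinality of a set of values (distinct letters are counted once), and let $lb(w)=\sum_j lb(a_j)$, and similarly for $ls,rb,rs$. For a partition $\pi$, $lb(\pi)=lb(w(\pi))$, etc. $$F_{n,k}(\omega)=F_{n,k}(\omega;q,r,s,t)=\sum_{\pi\in\Pi_{n,k}(\omega)}q^{lb(\pi)}r^{ls(\pi)}s^{rb(\pi)}t^{rs(\pi)}.$$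 Convention: $\binom{0}{2}=\binom{1}{2}=0$. *)

theory Defs
  imports Complex_Main "HOL-Library.Disjoint_Sets"
begin

(* A set partition is the set of its (nonempty) blocks; being a partition of A is
   the library's partition_on A. *)

definition restrict_partition :: "nat set \<Rightarrow> nat set set \<Rightarrow> nat set set" where
  "restrict_partition S P = {B \<inter> S | B. B \<in> P \<and> B \<inter> S \<noteq> {}}"

(* The i-th smallest element of a finite set S has rank i. *)
definition rank_in :: "nat set \<Rightarrow> nat \<Rightarrow> nat" where
  "rank_in S x = card {y \<in> S. y \<le> x}"

definition standardize :: "nat set \<Rightarrow> nat set set \<Rightarrow> nat set set" where
  "standardize S P = (`) (rank_in S) ` P"

(* The ground set of the partition P is its union. *)
definition contains_pattern :: "nat set set \<Rightarrow> nat set set \<Rightarrow> bool" where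
  "contains_pattern P \<omega> \<longleftrightarrow> (\<exists>S \<subseteq> \<Union>P. standardize S (restrict_partition S P) = \<omega>)"

definition avoiders :: "nat \<Rightarrow> nat \<Rightarrow> nat set set \<Rightarrow> nat set set set" where
  "avoiders n k \<omega> = {P. partition_on {1..n} P \<and> card P = k \<and> \<not> contains_pattern P \<omega>}"

(* [B_1, ..., B_k] with Min B_1 < ... < Min B_k; list positions start at 0, so the
   block B_j is blocks P ! (j - 1). *)
definition blocks :: "nat set set \<Rightarrow> nat set list" where
  "blocks P = sorted_key_list_of_set Min P"

definition letter :: "nat set set \<Rightarrow> nat \<Rightarrow> nat" where
  "letter P i = (THE j. j \<in> {1..card P} \<and> i \<in> blocks P ! (j - 1))"

(* The word a_1 ... a_n, so that a_i is rgf n P ! (i - 1). *)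
definition rgf :: "nat \<Rightarrow> nat set set \<Rightarrow> nat list" where
  "rgf n P = map (letter P) [1..<n + 1]"

(* All four statistics count distinct values, not positions. *)
definition lb :: "nat list \<Rightarrow> nat" where
  "lb w = (\<Sum>j<length w. card {w ! i | i. i < j \<and> w ! i > w ! j})"

definition ls :: "nat list \<Rightarrow> nat" where
  "ls w = (\<Sum>j<length w. card {w ! i | i. i < j \<and> w ! i < w ! j})"

definition rb :: "nat list \<Rightarrow> nat" where
  "rb w = (\<Sum>j<length w. card {w ! i | i. j < i \<and> i < length w \<and> w ! i > w ! j})"

definition rs :: "nat list \<Rightarrow> nat" where
  "rs w = (\<Sum>j<length w. card {w ! i | i. j < i \<and> i < length w \<and> w ! i < w ! j})"

(* The polynomial F_{n,k}(\<omega>; q,r,s,t) is represented by its value at arbitrary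
   elements q, r, s, t of an arbitrary commutative semiring; the indeterminates of a
   polynomial ring are a special case. *)
definition F :: "nat \<Rightarrow> nat \<Rightarrow> nat set set \<Rightarrow>
    'a::comm_semiring_1 \<Rightarrow> 'a \<Rightarrow> 'a \<Rightarrow> 'a \<Rightarrow> 'a" where
  "F n k \<omega> q r s t =
    (\<Sum>P\<in>avoiders n k \<omega>.
      q ^ lb (rgf n P) * r ^ ls (rgf n P) * s ^ rb (rgf n P) * t ^ rs (rgf n P))"

lemma finite_avoiders: "finite (avoiders n k \<omega>)"
  by (rule finite_subset[OF _ finitely_many_partition_on[of "{1..n}"]])
    (auto simp: avoiders_def)

lemma (in linorder) sorted_key_list_of_set_inj:
  assumes "inj_on f A" and "finite A"
  shows "set (sorted_key_list_of_set f A) = A \<and>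
    length (sorted_key_list_of_set f A) = card A \<and>
    sorted_wrt (<) (map f (sorted_key_list_of_set f A))"
proof -
  interpret folding_insort_key "(\<le>)" "(<)" A f
    by unfold_locales (fact assms(1))
  show ?thesis
    using assms(2) by simp
qed

lemma
  assumes "partition_on {1..n} P"
  shows set_blocks: "set (blocks P) = P"
    and length_blocks: "length (blocks P) = card P"
    and strict_sorted_blocks: "sorted_wrt (<) (map Min (blocks P))"
proof -
  have fin: "finite P"
    using assms finite_elements by blast
  have blk: "finite B \<and> B \<noteq> {}" if "B \<in> P" for B
    using assms that by (metis finite_atLeastAtMost finite_subset
        partition_onD1 partition_onD3 Union_upper)
  have "inj_on Min P"
  proof (rule inj_onI)
    fix A B assume "A \<in> P" "B \<in> P" "Min A = Min B"
    then have "Min A \<in> A \<inter> B"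
      using blk by (metis IntI Min_in)
    then show "A = B"
      using partition_onD2[OF assms] \<open>A \<in> P\<close> \<open>B \<in> P\<close> by (auto dest: disjointD)
  qed
  from sorted_key_list_of_set_inj[OF this fin]
  show "set (blocks P) = P" "length (blocks P) = card P" "sorted_wrt (<) (map Min (blocks P))"
    unfolding blocks_def by blast+
qed

lemma
  assumes P: "partition_on {1..n} P" and i: "i \<in> {1..n}"
  shows letter_in: "letter P i \<in> {1..card P}"
    and letter_block: "i \<in> blocks P ! (letter P i - 1)"
proof -
  note blks = set_blocks[OF P] length_blocks[OF P] strict_sorted_blocks[OF P]
  have dist: "distinct (blocks P)"
    using blks(3) by (metis distinct_map strict_sorted_iff)
  obtain B where B: "B \<in> P" "i \<in> B"
    using i unfolding partition_onD1[OF P] by blast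
  then obtain j where j: "j < card P" "blocks P ! j = B"
    using blks by (metis in_set_conv_nth)
  have "\<exists>!j. j \<in> {1..card P} \<and> i \<in> blocks P ! (j - 1)"
  proof (rule ex1I[of _ "Suc j"])
    show "Suc j \<in> {1..card P} \<and> i \<in> blocks P ! (Suc j - 1)"
      using j B by simp
    fix l assume l: "l \<in> {1..card P} \<and> i \<in> blocks P ! (l - 1)"
    then have m: "l - 1 < length (blocks P)"
      using blks by auto
    then have "blocks P ! (l - 1) \<in> P"
      using blks nth_mem by blast
    then have "blocks P ! (l - 1) = B"
      using l B partition_onD2[OF P] by (auto dest: disjointD)
    then have "l - 1 = j"
      using j m dist blks by (metis nth_eq_iff_index_eq)
    then show "l = Suc j" using l by auto
  qed
  from theI'[OF this] show "letter P i \<in> {1..card P}" "i \<in> blocks P ! (letter P i - 1)"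
    unfolding letter_def by auto
qed

end

theory Submission
  imports Defs
begin

text \<open>
  A partition avoids 1/23 iff any two elements \<open>b < c\<close> of a common block have everything below
  \<open>b\<close> in that block as well. So every block other than the block \<open>X\<close> of 1 is a singleton, and
  \<open>X\<close> minus its maximum is an initial segment. With \<open>k\<close> blocks and \<open>n = m + k\<close> this means
  \<open>X = {1, \<dots>, m} \<union> {m + j}\<close> for some \<open>1 \<le> j \<le> k\<close> (only \<open>j = 1\<close> if \<open>m = 0\<close>), with word
  \<open>1\<^sup>m 2 3 \<dots> j 1 (j+1) \<dots> k\<close>, whose four statistics are read off directly.
\<close>

section \<open>The statistics under extension of a word by one letter\<close>

lemma rb_Nil: "rb [] = 0" and rs_Nil: "rs [] = 0" and lb_Nil: "lb [] = 0" and ls_Nil: "ls [] = 0"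
  by (simp_all add: rb_def rs_def lb_def ls_def)

text \<open>Prepending a letter changes nothing to the right of the old letters, so the right
  statistics recurse along \<open>Cons\<close>. The predicate \<open>Q\<close> serves
  \<open>rb\<close> and \<open>rs\<close> alike.\<close>

lemma Cons_later_values:
  "{(x # w) ! i | i. Suc j < i \<and> i < length (x # w) \<and> Q ((x # w) ! i)} =
    {w ! i | i. j < i \<and> i < length w \<and> Q (w ! i)}" (is "?A = ?B")
proof
  show "?A \<subseteq> ?B"
  proof
    fix y assume "y \<in> ?A"
    then obtain i where i: "y = (x # w) ! i" "Suc j < i" "i < length (x # w)" "Q ((x # w) ! i)"
      by blast
    then obtain i' where "i = Suc i'" by (cases i) auto
    with i show "y \<in> ?B" by auto
  qed
  show "?B \<subseteq> ?A"
  proof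
    fix y assume "y \<in> ?B"
    then obtain i where "y = w ! i" "j < i" "i < length w" "Q (w ! i)" by blast
    then have "y = (x # w) ! Suc i \<and> Suc j < Suc i \<and> Suc i < length (x # w) \<and> Q ((x # w) ! Suc i)"
      by simp
    then show "y \<in> ?A" by blast
  qed
qed

lemma Cons_head_later_values:
  "{(x # w) ! i | i. 0 < i \<and> i < length (x # w) \<and> Q ((x # w) ! i)} = {y \<in> set w. Q y}" (is "?A = ?B")
proof
  show "?A \<subseteq> ?B"
  proof
    fix y assume "y \<in> ?A"
    then obtain i where i: "y = (x # w) ! i" "0 < i" "i < length (x # w)" "Q ((x # w) ! i)"
      by blast
    then obtain i' where "i = Suc i'" by (cases i) auto
    with i show "y \<in> ?B" by auto
  qed
  show "?B \<subseteq> ?A"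
  proof
    fix y assume "y \<in> ?B"
    then obtain i where "y = w ! i" "i < length w" "Q y" by (auto simp: in_set_conv_nth)
    then have "y = (x # w) ! Suc i \<and> 0 < Suc i \<and> Suc i < length (x # w) \<and> Q ((x # w) ! Suc i)"
      by simp
    then show "y \<in> ?A" by blast
  qed
qed

lemma rb_Cons: "rb (x # w) = card {y \<in> set w. y > x} + rb w"
  unfolding rb_def
  using Cons_head_later_values[of x w "\<lambda>y. y > x"] Cons_later_values[of x w _ "\<lambda>y. y > w ! _"]
  by (simp add: sum.lessThan_Suc_shift del: sum.lessThan_Suc)

lemma rs_Cons: "rs (x # w) = card {y \<in> set w. y < x} + rs w"
  unfolding rs_def
  using Cons_head_later_values[of x w "\<lambda>y. y < x"] Cons_later_values[of x w _ "\<lambda>y. y < w ! _"]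
  by (simp add: sum.lessThan_Suc_shift del: sum.lessThan_Suc)

lemma snoc_earlier_values:
  assumes "j \<le> length w"
  shows "{(w @ [x]) ! i | i. i < j \<and> Q ((w @ [x]) ! i)} = {w ! i | i. i < j \<and> Q (w ! i)}"
proof -
  have "(w @ [x]) ! i = w ! i" if "i < j" for i
    using assms that by (simp add: nth_append)
  then show ?thesis by (metis (lifting))
qed

lemma earlier_values: "{w ! i | i. i < length w \<and> Q (w ! i)} = {y \<in> set w. Q y}"
  by (auto simp: in_set_conv_nth)

text \<open>Mirror image for the left statistics: an appended letter precedes no other, so the old
  contributions persist. \<open>Q\<close> is \<open>>\<close> for \<open>lb\<close> and
  \<open><\<close> for \<open>ls\<close>.\<close>

lemma sum_earlier_values_snoc:
  "(\<Sum>j<length (w @ [x]). card {(w @ [x]) ! i | i. i < j \<and> Q ((w @ [x]) ! i) ((w @ [x]) ! j)}) =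
    (\<Sum>j<length w. card {w ! i | i. i < j \<and> Q (w ! i) (w ! j)}) + card {y \<in> set w. Q y x}"
proof -
  have "card {(w @ [x]) ! i | i. i < j \<and> Q ((w @ [x]) ! i) ((w @ [x]) ! j)} =
      card {w ! i | i. i < j \<and> Q (w ! i) (w ! j)}" if "j < length w" for j
  proof -
    have "(w @ [x]) ! j = w ! j" using that by (simp add: nth_append)
    then show ?thesis
      using snoc_earlier_values[of j w x "\<lambda>y. Q y (w ! j)"] that by (simp only: less_imp_le)
  qed
  moreover have "{(w @ [x]) ! i | i. i < length w \<and> Q ((w @ [x]) ! i) ((w @ [x]) ! length w)} =
      {y \<in> set w. Q y x}"
    using snoc_earlier_values[of "length w" w x "\<lambda>y. Q y x"] earlier_values[of w "\<lambda>y. Q y x"]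
    by (simp only: nth_append_length order_refl)
  ultimately show ?thesis
    unfolding length_append_singleton sum.lessThan_Suc by (auto intro!: sum.cong)
qed

lemma lb_snoc: "lb (w @ [x]) = lb w + card {y \<in> set w. y > x}"
  unfolding lb_def by (rule sum_earlier_values_snoc)

lemma ls_snoc: "ls (w @ [x]) = ls w + card {y \<in> set w. y < x}"
  unfolding ls_def by (rule sum_earlier_values_snoc)

section \<open>The statistics of the words of avoiders\<close>

text \<open>\<open>j\<close> marks where the last 1 stands. For \<open>m = 0\<close> and
  \<open>j > 1\<close> the word starts with 2 and is no restricted growth function, whence the side
  condition in \<open>ls_hook_word\<close>.\<close>

definition hook_word :: "nat \<Rightarrow> nat \<Rightarrow> nat \<Rightarrow> nat list" where
  "hook_word m k j = replicate m 1 @ [2..<Suc j] @ 1 # [Suc j..<Suc k]"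

lemma choose_two_Suc: "Suc n choose 2 = n + (n choose 2)"
  by (simp add: numeral_2_eq_2)

section \<open>Right statistics of the hook words\<close>

lemma rb_upt: "rb [i..<Suc k] = (Suc k - i) choose 2"
proof (induction "Suc k - i" arbitrary: i)
  case 0
  then show ?case by (simp add: rb_Nil)
next
  case (Suc d)
  then have ik: "i \<le> k" by simp
  have "{y \<in> set [Suc i..<Suc k]. y > i} = {Suc i..k}" by auto
  with ik Suc(1)[of "Suc i"] Suc(2) show ?case
    by (simp add: upt_conv_Cons rb_Cons Suc_diff_le choose_two_Suc del: upt_Suc)
qed

text \<open>Downward induction on \<open>i\<close>: the 1 sees the \<open>k - j\<close> letters
  after it, and each of the letters \<open>i\<close> to \<open>j\<close> sees all larger letters up
  to \<open>k\<close>, since the interposed 1 is never larger.\<close>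

lemma rb_hook_tail:
  assumes "j \<le> k" "2 \<le> i" "i \<le> Suc j"
  shows "rb ([i..<Suc j] @ 1 # [Suc j..<Suc k]) = (k - j) + ((Suc k - i) choose 2)"
  using assms(3,2)
proof (induction rule: inc_induct)
  case base
  have "{y \<in> set [Suc j..<Suc k]. y > 1} = {Suc j..k}" using base by auto
  then show ?case by (simp add: rb_Cons rb_upt del: upt_Suc)
next
  case (step i)
  have "{y \<in> set ([Suc i..<Suc j] @ 1 # [Suc j..<Suc k]). y > i} = {Suc i..k}"
    using step assms by auto
  with step assms show ?case
    by (simp add: upt_conv_Cons rb_Cons Suc_diff_le choose_two_Suc del: upt_Suc set_append)
qed

lemma rb_replicate_append: "rb (replicate m x @ w) = m * card {y \<in> set w. y > x} + rb w"
proof (induction m)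
  case (Suc m)
  have "{y \<in> set (replicate m x @ w). y > x} = {y \<in> set w. y > x}" by auto
  with Suc show ?case by (simp add: rb_Cons)
qed simp

text \<open>The summands come from the \<open>m\<close> leading 1s, each seeing
  \<open>{2..k}\<close>, from the later 1, and from the pairs among the increasing letters 2 to
  \<open>k\<close>.\<close>

lemma rb_hook_word:
  assumes "1 \<le> j" "j \<le> k"
  shows "rb (hook_word m k j) = m * (k - 1) + (k - j) + ((k - 1) choose 2)"
proof -
  have "{y \<in> set ([2..<Suc j] @ 1 # [Suc j..<Suc k]). y > 1} = {2..k}"
    using assms by auto
  then show ?thesis
    using rb_hook_tail[of j k 2] assms
    by (simp add: hook_word_def rb_replicate_append del: upt_Suc set_append)
qed

lemma rs_upt: "rs [i..<Suc k] = 0"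
proof (induction "Suc k - i" arbitrary: i)
  case 0
  then show ?case by (simp add: rs_Nil)
next
  case (Suc d)
  have "{y \<in> set [Suc i..<Suc k]. y < i} = {}" by auto
  with Suc(1)[of "Suc i"] Suc(2) show ?case
    by (simp add: upt_conv_Cons rs_Cons del: upt_Suc)
qed

text \<open>The later 1 is the only descent target: each of the letters \<open>i\<close> to
  \<open>j\<close> sees exactly this one smaller value, every other letter none.\<close>

lemma rs_hook_tail:
  assumes "2 \<le> i" "i \<le> Suc j"
  shows "rs ([i..<Suc j] @ 1 # [Suc j..<Suc k]) = Suc j - i"
  using assms(2,1)
proof (induction rule: inc_induct)
  case base
  have "{y \<in> set [Suc j..<Suc k]. y < 1} = {}" by auto
  then show ?case by (simp add: rs_Cons rs_upt del: upt_Suc)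
next
  case (step i)
  have "{y \<in> set ([Suc i..<Suc j] @ 1 # [Suc j..<Suc k]). y < i} = {1}"
    using step by auto
  with step show ?case
    by (simp add: upt_conv_Cons rs_Cons del: upt_Suc set_append)
qed

lemma rs_hook_word:
  assumes "1 \<le> j"
  shows "rs (hook_word m k j) = j - 1"
proof -
  have "rs (replicate m 1 @ [2..<Suc j] @ 1 # [Suc j..<Suc k]) = Suc j - 2"
  proof (induction m)
    case 0
    then show ?case using rs_hook_tail[of 2 j k] assms by simp
  next
    case (Suc m)
    have "{y \<in> set (replicate m 1 @ [2..<Suc j] @ 1 # [Suc j..<Suc k]). y < 1} = {}"
      by auto
    with Suc show ?case by (simp add: rs_Cons del: upt_Suc set_append)
  qed
  then show ?thesis by (simp add: hook_word_def)
qed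

section \<open>Left statistics of the hook words\<close>

lemma lb_snoc_greatest:
  assumes "\<forall>y\<in>set w. y \<le> x"
  shows "lb (w @ [x]) = lb w"
proof -
  have "{y \<in> set w. y > x} = {}" using assms by auto
  then show ?thesis by (simp only: lb_snoc card.empty)
qed

lemma lb_append_upt:
  assumes "\<forall>y\<in>set w. y \<le> i"
  shows "lb (w @ [i..<i + d]) = lb w"
proof (induction d)
  case (Suc d)
  have "\<forall>y\<in>set (w @ [i..<i + d]). y \<le> i + d" using assms by auto
  with Suc show ?case using lb_snoc_greatest[of "w @ [i..<i + d]"] by simp
qed simp

lemma lb_replicate: "lb (replicate m x) = 0"
proof (induction m)
  case (Suc m)
  then show ?case
    using lb_snoc_greatest[of "replicate m x" x] by (simp add: replicate_append_same)
qed (simp add: lb_Nil)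

lemma lb_hook_word:
  assumes "1 \<le> j" "j \<le> k"
  shows "lb (hook_word m k j) = j - 1"
proof -
  let ?u = "replicate m 1 @ [2..<Suc j]"
  \<comment> \<open>The upper end is rewritten to fit \<open>lb_append_upt\<close>. Increasing runs
    add nothing, so only the later 1 contributes, seeing \<open>{2..j}\<close> on its left.\<close>
  have "lb (hook_word m k j) = lb ((?u @ [1]) @ [Suc j..<Suc j + (k - j)])"
    using assms by (simp add: hook_word_def del: upt_Suc)
  also have "\<dots> = lb (?u @ [1])"
    by (rule lb_append_upt) auto
  also have "\<dots> = lb ?u + card {y \<in> set ?u. y > 1}"
    by (rule lb_snoc)
  also have "{y \<in> set ?u. y > 1} = {2..j}" by auto
  also have "lb ?u = lb (replicate m 1 @ [2..<2 + (j - 1)])" using assms by simp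
  also have "\<dots> = 0" using lb_append_upt[of "replicate m 1" 2 "j - 1"] by (simp add: lb_replicate)
  finally show ?thesis by simp
qed

text \<open>Each appended letter \<open>x\<close> sees exactly \<open>{1..<x}\<close> and adds
  \<open>x - 1\<close>, so the binomials telescope. The correction term stands on the left to avoid
  truncated subtraction.\<close>

lemma ls_append_upt:
  assumes "set w = {1..<i}" and "1 \<le> i"
  shows "ls (w @ [i..<i + d]) + ((i - 1) choose 2) = ls w + ((i + d - 1) choose 2)"
proof (induction d)
  case (Suc d)
  have "{y \<in> set (w @ [i..<i + d]). y < i + d} = {1..<i + d}"
    using assms by auto
  moreover obtain e where "i + d = Suc e" using assms(2) by (cases "i + d") auto
  ultimately show ?case
    using Suc ls_snoc[of "w @ [i..<i + d]" "i + d"] by (simp add: choose_two_Suc)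
qed simp

lemma ls_replicate: "ls (replicate m x) = 0"
proof (induction m)
  case (Suc m)
  have "{y \<in> set (replicate m x). y < x} = {}" by auto
  with Suc show ?case
    using ls_snoc[of "replicate m x" x] by (simp add: replicate_append_same)
qed (simp add: ls_Nil)

text \<open>The first occurrence of a letter \<open>a\<close> contributes \<open>a - 1\<close> and
  every 1 contributes 0, so neither \<open>m\<close> nor \<open>j\<close> matters. The side
  condition puts a 1 before the letters 2 to \<open>j\<close>.\<close>

lemma ls_hook_word:
  assumes "1 \<le> j" "j \<le> k" "m = 0 \<longrightarrow> j = 1"
  shows "ls (hook_word m k j) = k choose 2"
proof -
  let ?u = "replicate m 1 @ [2..<Suc j]"
  have u: "ls ?u = j choose 2"
  proof (cases "m = 0")
    case True
    then show ?thesis using assms by (simp add: ls_Nil)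
  next
    case False
    have "set (replicate m (1::nat)) = {1..<2}" using False by auto
    from ls_append_upt[OF this, of "j - 1"] assms show ?thesis
      by (simp add: ls_replicate numeral_2_eq_2 del: upt_Suc)
  qed
  have "{y \<in> set ?u. y < 1} = {}" by auto
  then have u1: "ls (?u @ [1]) = j choose 2"
    using u by (simp only: ls_snoc card.empty)
  have "set (?u @ [1]) = {1..<Suc j}" using assms by auto
  from ls_append_upt[OF this, of "k - j"] u1 assms show ?thesis
    by (simp add: hook_word_def del: upt_Suc)
qed

section \<open>Avoiders of 1/23\<close>

lemma rank_in_less:
  assumes "finite S" "y \<in> S" "x < y"
  shows "rank_in S x < rank_in S y"
  unfolding rank_in_def
proof (rule psubset_card_mono)
  have "y \<in> {z \<in> S. z \<le> y}" "y \<notin> {z \<in> S. z \<le> x}" using assms by auto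
  then show "{z \<in> S. z \<le> x} \<subset> {z \<in> S. z \<le> y}" using assms(3) by fastforce
qed (use assms(1) in simp)

text \<open>Forward, the elements of rank 1, 2, 3 are the witnesses, ordered because rank is
  strictly increasing on \<open>S\<close>. Backward, \<open>S\<close> is
  \<open>{a, b, c}\<close>.\<close>

lemma contains_1_23_iff:
  assumes "finite (\<Union>P)" and "disjoint P"
  shows "contains_pattern P {{1}, {2, 3}} \<longleftrightarrow>
    (\<exists>A\<in>P. \<exists>B\<in>P. A \<noteq> B \<and> (\<exists>a\<in>A. \<exists>b\<in>B. \<exists>c\<in>B. a < b \<and> b < c))"
proof
  assume "contains_pattern P {{1}, {2, 3}}"
  then obtain S where S: "S \<subseteq> \<Union>P" "standardize S (restrict_partition S P) = {{1}, {2, 3}}"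
    unfolding contains_pattern_def by blast
  have fin: "finite S" using S(1) assms(1) finite_subset by blast
  have rank_mono: "x < y" if "rank_in S x < rank_in S y" "x \<in> S" "y \<in> S" for x y
    using that by (metis linorder_less_linear order_less_asym rank_in_less[OF fin])
  have img: "\<exists>B\<in>P. rank_in S ` (B \<inter> S) = V" if "V \<in> {{1}, {2, 3}}" for V
    using that unfolding S(2)[symmetric] standardize_def restrict_partition_def by blast
  obtain A where A: "A \<in> P" "rank_in S ` (A \<inter> S) = {1}" using img by blast
  obtain B where B: "B \<in> P" "rank_in S ` (B \<inter> S) = {2, 3}" using img by blast
  obtain a where a: "a \<in> A" "a \<in> S" "rank_in S a = 1" using A(2) by blast
  have "2 \<in> rank_in S ` (B \<inter> S)" using B(2) by simp
  then obtain b where b: "b \<in> B" "b \<in> S" "rank_in S b = 2" by force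
  have "3 \<in> rank_in S ` (B \<inter> S)" using B(2) by simp
  then obtain c where c: "c \<in> B" "c \<in> S" "rank_in S c = 3" by force
  have "A \<noteq> B" using A(2) B(2) by auto
  moreover have "a < b" "b < c" using rank_mono a b c by auto
  ultimately show "\<exists>A\<in>P. \<exists>B\<in>P. A \<noteq> B \<and> (\<exists>a\<in>A. \<exists>b\<in>B. \<exists>c\<in>B. a < b \<and> b < c)"
    using A(1) B(1) a(1) b(1) c(1) by blast
next
  assume "\<exists>A\<in>P. \<exists>B\<in>P. A \<noteq> B \<and> (\<exists>a\<in>A. \<exists>b\<in>B. \<exists>c\<in>B. a < b \<and> b < c)"
  then obtain A B a b c where *: "A \<in> P" "B \<in> P" "A \<noteq> B" "a \<in> A" "b \<in> B" "c \<in> B" "a < b" "b < c"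
    by blast
  let ?S = "{a, b, c}"
  have other: "x \<notin> D" if "x \<in> C" "C \<in> P" "D \<in> P" "C \<noteq> D" for x C D
    using assms(2) that by (auto dest: disjointD)
  have AS: "A \<inter> ?S = {a}" and BS: "B \<inter> ?S = {b, c}"
    using * other[of _ A B] other[of _ B A] by auto
  have CS: "C \<inter> ?S = {}" if "C \<in> P" "C \<noteq> A" "C \<noteq> B" for C
    using * that other[of _ A C] other[of _ B C] by auto
  have "restrict_partition ?S P = {{a}, {b, c}}"
  proof
    have "C \<inter> ?S = {} \<or> C \<inter> ?S \<in> {{a}, {b, c}}" if "C \<in> P" for C
      using AS BS CS[OF that] by (cases "C = A \<or> C = B") auto
    then show "restrict_partition ?S P \<subseteq> {{a}, {b, c}}"
      unfolding restrict_partition_def by fast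
    have "{a} \<in> restrict_partition ?S P" "{b, c} \<in> restrict_partition ?S P"
      unfolding restrict_partition_def mem_Collect_eq using AS BS *(1,2)
      by (metis insert_not_empty)+
    then show "{{a}, {b, c}} \<subseteq> restrict_partition ?S P" by blast
  qed
  moreover have "{y \<in> ?S. y \<le> a} = {a}" "{y \<in> ?S. y \<le> b} = {a, b}" "{y \<in> ?S. y \<le> c} = {a, b, c}"
    using * by auto
  then have "rank_in ?S a = 1" "rank_in ?S b = 2" "rank_in ?S c = 3"
    unfolding rank_in_def using * by simp_all
  ultimately have "standardize ?S (restrict_partition ?S P) = {{1}, {2, 3}}"
    by (simp add: standardize_def)
  moreover have "?S \<subseteq> \<Union>P" using * by auto
  ultimately show "contains_pattern P {{1}, {2, 3}}"
    unfolding contains_pattern_def by blast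
qed

text \<open>The block of 1 when \<open>n = m + k\<close>: if the other \<open>k - 1\<close> blocks
  are singletons, \<open>m + 1\<close> elements remain for it. For \<open>m = 0\<close> it contains
  1 only if \<open>j = 1\<close>.\<close>

definition hook :: "nat \<Rightarrow> nat \<Rightarrow> nat set" where
  "hook m j = insert (m + j) {1..m}"

definition hook_partition :: "nat \<Rightarrow> nat \<Rightarrow> nat \<Rightarrow> nat set set" where
  "hook_partition m k j = insert (hook m j) ((\<lambda>i. {i}) ` ({1..m + k} - hook m j))"

lemma hook_subset:
  assumes "1 \<le> j" "j \<le> k"
  shows "hook m j \<subseteq> {1..m + k}"
  using assms by (auto simp: hook_def)

lemma partition_on_hook_partition:
  assumes "1 \<le> j" "j \<le> k"
  shows "partition_on {1..m + k} (hook_partition m k j)"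
proof (rule partition_onI)
  show "\<Union> (hook_partition m k j) = {1..m + k}"
    using hook_subset[OF assms] by (auto simp: hook_partition_def)
  show "{} \<notin> hook_partition m k j"
    by (auto simp: hook_partition_def hook_def)
  show "disjnt p p'" if "p \<in> hook_partition m k j" "p' \<in> hook_partition m k j" "p \<noteq> p'" for p p'
    using that by (auto simp: hook_partition_def)
qed

lemma card_hook: "1 \<le> j \<Longrightarrow> card (hook m j) = Suc m"
  by (simp add: hook_def)

text \<open>Used in both directions: to count the blocks of a hook partition, and to find the size
  of the block of 1 from the number of blocks.\<close>

lemma card_insert_singletons:
  assumes "finite A" "X \<subseteq> A"
  shows "card (insert X ((\<lambda>i. {i}) ` (A - X))) = Suc (card A - card X)"
proof -
  have "X \<notin> (\<lambda>i. {i}) ` (A - X)" by auto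
  then show ?thesis
    using assms by (simp add: card_image card_Diff_subset finite_subset)
qed

lemma hook_partition_in_avoiders:
  assumes "1 \<le> j" "j \<le> k"
  shows "hook_partition m k j \<in> avoiders (m + k) k {{1}, {2, 3}}"
proof -
  let ?P = "hook_partition m k j"
  note part = partition_on_hook_partition[OF assms, of m]
  have "card ?P = k"
    using card_insert_singletons[OF _ hook_subset[OF assms], of m] card_hook[OF assms(1), of m] assms
    by (simp add: hook_partition_def)
  moreover have "\<not> contains_pattern ?P {{1}, {2, 3}}"
  proof (subst contains_1_23_iff)
    show "finite (\<Union> ?P)" "disjoint ?P"
      using part by (auto simp: partition_on_def)
    show "\<not> (\<exists>A\<in>?P. \<exists>B\<in>?P. A \<noteq> B \<and> (\<exists>a\<in>A. \<exists>b\<in>B. \<exists>c\<in>B. a < b \<and> b < c))"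
    proof clarify
      fix A B a b c
      assume *: "A \<in> ?P" "B \<in> ?P" "A \<noteq> B" "a \<in> A" "b \<in> B" "c \<in> B" "a < b" "b < c"
      \<comment> \<open>Only the hook can have two elements. As \<open>b\<close> is not its maximum
        \<open>m + j\<close>, it is at most \<open>m\<close>, and then everything below
        \<open>b\<close> lies in the hook too.\<close>
      have B: "B = hook m j" using * by (auto simp: hook_partition_def)
      have "b \<le> m" using * assms unfolding B by (auto simp: hook_def)
      moreover have "a \<in> {1..m + k}" using * part by (auto simp: partition_on_def)
      ultimately have "a \<in> B" using * unfolding B by (auto simp: hook_def)
      then show False
        using * partition_onD2[OF part] by (auto dest: disjointD)
    qed
  qed
  ultimately show ?thesis using part by (simp add: avoiders_def)
qed

text \<open>The maximum pulls in everything below it; writing it as \<open>card Y\<close> lets the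
  block size determine the interval.\<close>

lemma down_closed_eq_atLeastAtMost:
  assumes "finite Y" "0 \<notin> Y" "\<And>a b. b \<in> Y \<Longrightarrow> 1 \<le> a \<Longrightarrow> a < b \<Longrightarrow> a \<in> Y"
  shows "Y = {1..card Y}"
proof (cases "Y = {}")
  case False
  have "Y = {1..Max Y}"
  proof
    show "Y \<subseteq> {1..Max Y}" using assms(1,2) by (auto simp: Suc_le_eq intro: gr0I)
    show "{1..Max Y} \<subseteq> Y"
      using assms(3)[OF Max_in[OF assms(1) False]] Max_in[OF assms(1) False]
      by (metis atLeastAtMost_iff le_neq_implies_less subsetI)
  qed
  then show ?thesis by (metis card_atLeastAtMost diff_Suc_1)
qed simp

lemma avoider_eq_hook_partition:
  assumes P: "P \<in> avoiders (m + k) k {{1}, {2, 3}}" and k: "1 \<le> k"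
  obtains j where "1 \<le> j" "j \<le> k" "m = 0 \<longrightarrow> j = 1" "P = hook_partition m k j"
proof -
  let ?n = "m + k"
  have part: "partition_on {1..?n} P" and card: "card P = k"
    and avoid: "\<not> contains_pattern P {{1}, {2, 3}}"
    using P by (auto simp: avoiders_def)
  have Un: "\<Union>P = {1..?n}" using part by (auto simp: partition_on_def)
  \<comment> \<open>Avoidance as a rule, used twice: with \<open>a = 1\<close> it forces singletons
    outside \<open>X\<close>, and with \<open>c = Max X\<close> it makes the rest of
    \<open>X\<close> downward closed.\<close>
  have avoid: "A = B" if "A \<in> P" "B \<in> P" "a \<in> A" "b \<in> B" "c \<in> B" "a < b" "b < c" for A B a b c
    using avoid that contains_1_23_iff[OF _ partition_onD2[OF part]] unfolding Un by blast
  have sub: "B \<subseteq> {1..?n}" if "B \<in> P" for B using that Un by auto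
  have uniq: "A = B" if "A \<in> P" "B \<in> P" "x \<in> A" "x \<in> B" for A B x
    using that partition_onD2[OF part] by (auto dest: disjointD)
  have "1 \<in> \<Union>P" unfolding Un using k by simp
  then obtain X where X: "X \<in> P" "1 \<in> X" by blast
  have fin: "finite X" using sub[OF X(1)] finite_subset by blast
  have single: "B = {i}" if "B \<in> P" "B \<noteq> X" "i \<in> B" for B i
  proof -
    have "c = b" if bc: "b \<in> B" "c \<in> B" for b c
    proof (rule ccontr)
      assume "c \<noteq> b"
      then have "\<exists>b c. b \<in> B \<and> c \<in> B \<and> b < c" using bc by (metis linorder_neqE_nat)
      then obtain b c where bc: "b \<in> B" "c \<in> B" "b < c" by blast
      have "b \<noteq> 1" using uniq X \<open>B \<in> P\<close> \<open>B \<noteq> X\<close> bc by metis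
      moreover have "1 \<le> b" using sub[OF \<open>B \<in> P\<close>] bc by auto
      ultimately show False
        using avoid[OF X(1) \<open>B \<in> P\<close> X(2) bc(1,2)] bc(3) \<open>B \<noteq> X\<close> by simp
    qed
    then show ?thesis using that(3) by blast
  qed
  have P_eq: "P = insert X ((\<lambda>i. {i}) ` ({1..?n} - X))"
  proof
    show "P \<subseteq> insert X ((\<lambda>i. {i}) ` ({1..?n} - X))"
    proof
      fix B assume B: "B \<in> P"
      show "B \<in> insert X ((\<lambda>i. {i}) ` ({1..?n} - X))"
      proof (cases "B = X")
        case False
        obtain i where i: "i \<in> B" using B partition_onD3[OF part] by (metis ex_in_conv)
        have "i \<notin> X" using uniq B X(1) i False by blast
        moreover have "i \<in> {1..?n}" using sub[OF B] i by blast
        ultimately show ?thesis using single[OF B False i] by blast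
      qed simp
    qed
    show "insert X ((\<lambda>i. {i}) ` ({1..?n} - X)) \<subseteq> P"
    proof -
      have "{i} \<in> P" if i: "i \<in> {1..?n} - X" for i
      proof -
        obtain B where B: "B \<in> P" "i \<in> B" using i Un by blast
        then have "B = {i}" using single i by blast
        then show ?thesis using B by simp
      qed
      then show ?thesis using X(1) by blast
    qed
  qed
  \<comment> \<open>This bound makes the truncated difference in
    \<open>card_insert_singletons\<close> exact.\<close>
  have "card X \<le> ?n" using card_mono[OF _ sub[OF X(1)]] by simp
  then have card_X: "card X = Suc m"
    using card_insert_singletons[OF _ sub[OF X(1)]] card unfolding P_eq[symmetric] by simp
  define x where "x = Max X"
  have x: "x \<in> X" unfolding x_def using fin X(2) by (metis Max_in empty_iff)
  have le_x: "y \<le> x" if "y \<in> X" for y using that fin by (simp add: x_def)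
  have initial: "X - {x} = {1..m}"
  proof -
    have "X - {x} = {1..card (X - {x})}"
    proof (rule down_closed_eq_atLeastAtMost)
      show "0 \<notin> X - {x}" using sub[OF X(1)] by auto
      fix a b assume ab: "b \<in> X - {x}" "1 \<le> a" "a < b"
      then have bx: "b < x" using le_x by (metis DiffE insertI1 le_neq_implies_less)
      have "a \<in> \<Union>P" unfolding Un using ab bx sub[OF X(1)] x by auto
      then obtain A where A: "A \<in> P" "a \<in> A" by blast
      then have "A = X" using avoid[OF A(1) X(1) A(2) _ x ab(3) bx] ab(1) by blast
      then show "a \<in> X - {x}" using A ab(3) bx by auto
    qed (use fin in simp)
    then show ?thesis using card_X x fin by simp
  qed
  \<comment> \<open>Hence \<open>x > m\<close>, so \<open>x - m\<close> is exact and serves as the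
    parameter \<open>j\<close>.\<close>
  have "x \<notin> {1..m}" using initial by blast
  moreover have "1 \<le> x" "x \<le> ?n" using sub[OF X(1)] x by auto
  ultimately have j: "1 \<le> x - m" "x - m \<le> k" "x = m + (x - m)" by auto
  have "X = hook m (x - m)" using initial x j(3) unfolding hook_def by (metis insert_Diff)
  then have "P = hook_partition m k (x - m)" using P_eq by (simp add: hook_partition_def)
  moreover have "x - m = 1" if "m = 0"
  proof -
    have "X - {x} = {}" unfolding initial that by simp
    then have "x = 1" using X(2) by blast
    then show ?thesis using that by simp
  qed
  ultimately show thesis using that j by blast
qed

text \<open>For \<open>m = 0\<close> every \<open>j\<close> gives the partition into singletons, so
  only \<open>j = 1\<close> is kept; this makes the parametrisation injective.\<close>

lemma avoiders_eq:
  assumes "1 \<le> k"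
  shows "avoiders (m + k) k {{1}, {2, 3}} = hook_partition m k ` {j \<in> {1..k}. m = 0 \<longrightarrow> j = 1}"
proof
  show "avoiders (m + k) k {{1}, {2, 3}} \<subseteq> hook_partition m k ` {j \<in> {1..k}. m = 0 \<longrightarrow> j = 1}"
    by (rule subsetI, erule avoider_eq_hook_partition[OF _ assms]) auto
  show "hook_partition m k ` {j \<in> {1..k}. m = 0 \<longrightarrow> j = 1} \<subseteq> avoiders (m + k) k {{1}, {2, 3}}"
    using hook_partition_in_avoiders by auto
qed

lemma inj_on_hook_partition: "inj_on (hook_partition m k) {j \<in> {1..k}. m = 0 \<longrightarrow> j = 1}"
proof (rule inj_onI)
  fix i j
  assume i: "i \<in> {j \<in> {1..k}. m = 0 \<longrightarrow> j = 1}" and j: "j \<in> {j \<in> {1..k}. m = 0 \<longrightarrow> j = 1}"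
    and eq: "hook_partition m k i = hook_partition m k j"
  have one: "1 \<in> hook m i" "1 \<in> hook m j" using i j by (auto simp: hook_def)
  have "hook m i \<in> hook_partition m k j" unfolding eq[symmetric] by (simp add: hook_partition_def)
  \<comment> \<open>The second case is impossible: 1 lies in both hooks, so the hook is recovered as
    the block of 1.\<close>
  then have "hook m i = hook m j \<or> (\<exists>x. x \<notin> hook m j \<and> hook m i = {x})"
    unfolding hook_partition_def by blast
  then have "hook m i = hook m j" using one by (metis singletonD)
  then have "m + i \<in> hook m j" unfolding hook_def by blast
  then show "i = j" using i by (auto simp: hook_def)
qed

section \<open>The words of avoiders\<close>

text \<open>The set of minima determines their sorted list, and \<open>Min\<close> is injective on
  blocks.\<close>

lemma blocks_eqI:
  assumes "partition_on {1..n} P" "set L = P" "sorted_wrt (<) (map Min L)"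
  shows "blocks P = L"
proof -
  note B = set_blocks[OF assms(1)] strict_sorted_blocks[OF assms(1)]
  have "map Min (blocks P) = map Min L"
    using strict_sorted_equal[OF assms(3) B(2)] B(1) assms(2) by (metis set_map)
  moreover have "inj_on Min (set (blocks P) \<union> set L)"
    using B assms(2) by (metis distinct_map strict_sorted_iff sup.idem)
  ultimately show ?thesis by (rule map_inj_on)
qed

lemma letter_eqI:
  assumes P: "partition_on {1..n} P" and j: "j < card P" "i \<in> blocks P ! j"
  shows "letter P i = Suc j"
proof -
  note blks = set_blocks[OF P] length_blocks[OF P] strict_sorted_blocks[OF P]
  have mem: "blocks P ! l \<in> P" if "l < card P" for l using that blks nth_mem by metis
  have "i \<in> {1..n}" using mem[OF j(1)] j(2) partition_onD1[OF P] by blast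
  note l = letter_in[OF P this] letter_block[OF P this]
  have "letter P i - 1 < card P" using l by auto
  then have "blocks P ! (letter P i - 1) = blocks P ! j"
    using mem j l(2) partition_onD2[OF P] by (auto dest: disjointD)
  moreover have "distinct (blocks P)"
    using blks(3) by (metis distinct_map strict_sorted_iff)
  ultimately have "letter P i - 1 = j"
    using j(1) \<open>letter P i - 1 < card P\<close> blks(2) by (metis nth_eq_iff_index_eq)
  then show ?thesis using l(1) by auto
qed

text \<open>The hook comes first because the side condition puts 1 into it; the singletons follow in
  increasing order.\<close>

lemma blocks_hook_partition:
  assumes "1 \<le> j" "j \<le> k" "m = 0 \<longrightarrow> j = 1"
  shows "blocks (hook_partition m k j) =
    hook m j # map (\<lambda>i. {i}) ([m + 1..<m + j] @ [m + j + 1..<m + k + 1])" (is "_ = ?L")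
proof (rule blocks_eqI[OF partition_on_hook_partition[OF assms(1,2)]])
  have "set ([m + 1..<m + j] @ [m + j + 1..<m + k + 1]) = {1..m + k} - hook m j"
    using assms by (auto simp: hook_def)
  then show "set ?L = hook_partition m k j"
    unfolding hook_partition_def by (simp only: list.set(2) set_map)
  have "Min (hook m j) = 1"
    by (rule Min_eqI) (use assms in \<open>auto simp: hook_def\<close>)
  then show "sorted_wrt (<) (map Min ?L)"
    using assms by (auto simp: sorted_wrt_append sorted_wrt_map comp_def simp del: upt_Suc)
qed

lemma rgf_hook_partition:
  assumes "1 \<le> j" "j \<le> k" "m = 0 \<longrightarrow> j = 1"
  shows "rgf (m + k) (hook_partition m k j) = hook_word m k j"
proof -
  let ?P = "hook_partition m k j"
  note part = partition_on_hook_partition[OF assms(1,2), of m]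
  note blks = blocks_hook_partition[OF assms]
  have card: "card ?P = k"
    using hook_partition_in_avoiders[OF assms(1,2), of m] by (simp add: avoiders_def)
  have hd: "letter ?P i = 1" if "i \<in> hook m j" for i
    using letter_eqI[OF part, of 0 i] that assms by (simp add: card blks)
  have mid: "letter ?P i = Suc (i - m)" if "m < i" "i < m + j" for i
    by (rule letter_eqI[OF part])
      (use that assms in \<open>auto simp: card blks nth_append nth_Cons' simp del: upt_Suc\<close>)
  \<comment> \<open>The element \<open>m + j\<close> belongs to the hook, so the singletons after it
    have an index lower by one than in \<open>mid\<close>.\<close>
  have last: "letter ?P i = Suc (i - m - 1)" if "m + j < i" "i \<le> m + k" for i
    by (rule letter_eqI[OF part])
      (use that assms in \<open>auto simp: card blks nth_append nth_Cons' simp del: upt_Suc\<close>)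
  have "[1..<m + k + 1] = [1..<m + 1] @ [m + 1..<m + j] @ (m + j) # [m + j + 1..<m + k + 1]"
    using assms upt_add_eq_append[of 1 "m + 1" "k"] upt_add_eq_append[of "m + 1" "m + j" "Suc (k - j)"]
    by (simp add: upt_conv_Cons del: upt_Suc)
  moreover have "map (letter ?P) [1..<m + 1] = replicate m 1"
    by (rule nth_equalityI) (auto simp: hd hook_def simp del: upt_Suc)
  moreover have "map (letter ?P) [m + 1..<m + j] = [2..<Suc j]"
    by (rule nth_equalityI) (use assms in \<open>auto simp: mid simp del: upt_Suc\<close>)
  moreover have "letter ?P (m + j) = 1" by (simp add: hd hook_def)
  moreover have "map (letter ?P) [m + j + 1..<m + k + 1] = [Suc j..<Suc k]"
    by (rule nth_equalityI) (use assms in \<open>auto simp: last simp del: upt_Suc\<close>)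
  ultimately show ?thesis unfolding rgf_def hook_word_def by simp
qed

theorem theorem3p1:
  fixes n k :: nat and q r s t :: "'a::comm_semiring_1"
  assumes "1 \<le> k" and "k \<le> n"
  shows "(n = k \<longrightarrow> F n k {{1}, {2, 3}} q r s t = (r * s) ^ (k choose 2)) \<and>
    (n > k \<longrightarrow> F n k {{1}, {2, 3}} q r s t =
      (\<Sum>j=1..k. (q * t) ^ (j - 1) * r ^ (k choose 2) *
        s ^ ((n - k) * (k - 1) + (k - j) + ((k - 1) choose 2))))"
proof -
  define m where "m = n - k"
  have n: "n = m + k" using assms by (simp add: m_def)
  let ?J = "{j \<in> {1..k}. m = 0 \<longrightarrow> j = 1}"
  let ?f = "\<lambda>j. (q * t) ^ (j - 1) * r ^ (k choose 2) *
    s ^ (m * (k - 1) + (k - j) + ((k - 1) choose 2))"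
  \<comment> \<open>On hook words \<open>lb\<close> and \<open>rs\<close> both equal
    \<open>j - 1\<close>, so \<open>q\<close> and \<open>t\<close> enter only through
    \<open>q * t\<close>.\<close>
  have F: "F n k {{1}, {2, 3}} q r s t = (\<Sum>j\<in>?J. ?f j)"
    unfolding F_def n avoiders_eq[OF assms(1)] sum.reindex[OF inj_on_hook_partition] comp_def
    by (rule sum.cong)
      (simp_all add: rgf_hook_partition lb_hook_word ls_hook_word rb_hook_word rs_hook_word
        power_mult_distrib mult_ac)
  have "(\<Sum>j\<in>?J. ?f j) = (r * s) ^ (k choose 2)" if "m = 0"
  proof -
    have "?J = {1}" using that assms by auto
    moreover obtain l where "k = Suc l" using assms by (cases k) auto
    \<comment> \<open>The exponent of \<open>s\<close> at \<open>j = 1\<close> is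
      \<open>(k - 1) + ((k - 1) choose 2)\<close>, which is \<open>k choose 2\<close>.\<close>
    ultimately show ?thesis
      using that by (simp add: choose_two_Suc power_mult_distrib)
  qed
  moreover have "?J = {1..k}" if "m > 0" using that by auto
  ultimately show ?thesis using F n by auto
qed

end
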